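(* Let $m \geq 3$ and $n \geq 3$. The fixed-support Wasserstein barycenter linear program, in the form $A\,(\mathrm{vec}(X_1);\dots;\mathrm{vec}(X_m)) = ((-1)^1u_1;\dots;(-1)^m u_m;\mathbf{0}_n;\dots;\mathbf{0}_n)$, $X_k\ge 0$, with constraint matrix $A$ as described in the context, is not a minimum-cost flow problem; in particular its constraint matrix $A$ is not totally unimodular.
   Context: Fixed-support Wasserstein barycenter problem: given $u_1,\dots,u_m\in\Delta^n=\{v\in\mathbb{R}^n_+:\mathbf{1}_n^\top v=1\}$ and nonnegative cost matrices $C_1,\dots,C_m\in\mathbb{R}_+^{n\times n}$, minimize $\sum_{k=1}^m\langle C_k,X_k\rangle$ over $X_1,\dots,X_m\in\mathbb{R}_+^{n\times n}$ subject to $X_k\mathbf{1}_n=u_k$ ($k\in[m]$) and $X_{k+1}^\top\mathbf{1}_n=X_k^\top\mathbf{1}_n$ ($k\in[m-1]$). With row-major vectorization $\mathrm{vec}(X)\in\mathbb{R}^{n^2}$, $E=I_n\otimes\mathbf{1}_n^\top$ and $G=\mathbf{1}_n^\top\otimes I_n$ (both $n\times n^2$), the constraint matrix $A\in\mathbb{R}^{(2m-1)n\times mn^2}$ has $2m-1$ block rows and $m$ block columns of width $n^2$: for $k=1,\dots,m$, block row $k$ has $(-1)^kE$ in block column $k$ and zeros elsewhere; for $k=1,\dots,m-1$, block row $m+k$ has $(-1)^{k+1}G$ in block column $k$, $(-1)^kG$ in block column $k+1$, zeros elsewhere. A minimum-cost flow problem is a linear program $\min c^\top x$ s.t. $Mx=b$,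 $l\le x\le u$, where $M$ is the node–arc incidence matrix of a directed graph (each column has exactly one $+1$ and one $-1$); such constraint matrices are totally unimodular. A matrix is totally unimodular if every square submatrix has determinant in $\{-1,0,1\}$. *)

theory Defs
  imports
    "Jordan_Normal_Form.Determinant"
    "Jordan_Normal_Form.DL_Submatrix"
    "Graph_Theory.Digraph"
    "HOL-Library.Extended_Real"
begin

definition totally_unimodular :: "real mat \<Rightarrow> bool" where
  "totally_unimodular A \<longleftrightarrow>
     (\<forall>I J. I \<subseteq> {..<dim_row A} \<longrightarrow> J \<subseteq> {..<dim_col A} \<longrightarrow> card I = card J \<longrightarrow>
        det (submatrix A I J) \<in> {-1, 0, 1})"

text \<open>Minimise \<open>c\<^sup>T x\<close> subject to \<open>M x = b\<close> and \<open>l \<le> x \<le> u\<close>. The bounds are extended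
  reals, so that variables without a finite upper or lower bound are allowed.\<close>

record linear_program =
  lp_cost :: "real vec"
  lp_matrix :: "real mat"
  lp_rhs :: "real vec"
  lp_lower :: "ereal vec"
  lp_upper :: "ereal vec"

definition wf_linear_program :: "linear_program \<Rightarrow> bool" where
  "wf_linear_program P \<longleftrightarrow>
     dim_vec (lp_cost P) = dim_col (lp_matrix P) \<and>
     dim_vec (lp_rhs P) = dim_row (lp_matrix P) \<and>
     dim_vec (lp_lower P) = dim_col (lp_matrix P) \<and>
     dim_vec (lp_upper P) = dim_col (lp_matrix P)"

text \<open>Nodes and arcs are identified with row and column indices; as any bijective labelling
  may be chosen, this does not restrict the graph. Parallel arcs are allowed; a loop would
  give a zero column and is excluded.\<close>

definition is_incidence_matrix :: "real mat \<Rightarrow> (nat, nat) pre_digraph \<Rightarrow> bool" where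
  "is_incidence_matrix M G \<longleftrightarrow>
     verts G = {..<dim_row M} \<and> arcs G = {..<dim_col M} \<and>
     (\<forall>v \<in> verts G. \<forall>a \<in> arcs G.
        M $$ (v, a) = (if v = tail G a then 1 else if v = head G a then -1 else 0))"

definition min_cost_flow_problem :: "linear_program \<Rightarrow> bool" where
  "min_cost_flow_problem P \<longleftrightarrow>
     wf_linear_program P \<and>
     (\<exists>G. fin_digraph G \<and> loopfree_digraph G \<and> is_incidence_matrix (lp_matrix P) G)"

definition kronecker :: "real mat \<Rightarrow> real mat \<Rightarrow> real mat" where
  "kronecker A B = mat (dim_row A * dim_row B) (dim_col A * dim_col B)
     (\<lambda>(i, j). A $$ (i div dim_row B, j div dim_col B) * B $$ (i mod dim_row B, j mod dim_col B))"

text \<open>Blocks are numbered from 1, entries within a block from 0.\<close>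

definition block_matrix ::
    "nat \<Rightarrow> nat \<Rightarrow> nat \<Rightarrow> nat \<Rightarrow> (nat \<Rightarrow> nat \<Rightarrow> real mat) \<Rightarrow> real mat" where
  "block_matrix R C p q B = mat (R * p) (C * q)
     (\<lambda>(i, j). B (i div p + 1) (j div q + 1) $$ (i mod p, j mod q))"

definition block_vector :: "nat \<Rightarrow> nat \<Rightarrow> (nat \<Rightarrow> real vec) \<Rightarrow> real vec" where
  "block_vector R p b = vec (R * p) (\<lambda>i. b (i div p + 1) $ (i mod p))"

definition vec_row_major :: "nat \<Rightarrow> real mat \<Rightarrow> real vec" where
  "vec_row_major n X = vec (n\<^sup>2) (\<lambda>i. X $$ (i div n, i mod n))"

definition ones_row :: "nat \<Rightarrow> real mat" where
  "ones_row n = mat 1 n (\<lambda>_. 1)"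

definition E_mat :: "nat \<Rightarrow> real mat" where
  "E_mat n = kronecker (1\<^sub>m n) (ones_row n)"

definition G_mat :: "nat \<Rightarrow> real mat" where
  "G_mat n = kronecker (ones_row n) (1\<^sub>m n)"

definition fswbp_block :: "nat \<Rightarrow> nat \<Rightarrow> nat \<Rightarrow> nat \<Rightarrow> real mat" where
  "fswbp_block m n r c =
     (if r \<le> m then
        (if c = r then (-1) ^ r \<cdot>\<^sub>m E_mat n else 0\<^sub>m n (n\<^sup>2))
      else let k = r - m in
        (if c = k then (-1) ^ (k + 1) \<cdot>\<^sub>m G_mat n
         else if c = k + 1 then (-1) ^ k \<cdot>\<^sub>m G_mat n
         else 0\<^sub>m n (n\<^sup>2)))"

definition fswbp_matrix :: "nat \<Rightarrow> nat \<Rightarrow> real mat" where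
  "fswbp_matrix m n = block_matrix (2 * m - 1) m n (n\<^sup>2) (fswbp_block m n)"

definition fswbp_rhs :: "nat \<Rightarrow> nat \<Rightarrow> (nat \<Rightarrow> real vec) \<Rightarrow> real vec" where
  "fswbp_rhs m n u =
     block_vector (2 * m - 1) n (\<lambda>r. if r \<le> m then (-1) ^ r \<cdot>\<^sub>v u r else 0\<^sub>v n)"

text \<open>The variable is the stacked vector of the \<open>vec(X\<^sub>1), \<dots>, vec(X\<^sub>m)\<close>.\<close>

definition fswbp_lp ::
    "nat \<Rightarrow> nat \<Rightarrow> (nat \<Rightarrow> real vec) \<Rightarrow> (nat \<Rightarrow> real mat) \<Rightarrow> linear_program" where
  "fswbp_lp m n u C =
     \<lparr> lp_cost = block_vector m (n\<^sup>2) (\<lambda>k. vec_row_major n (C k)),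
       lp_matrix = fswbp_matrix m n,
       lp_rhs = fswbp_rhs m n u,
       lp_lower = vec (m * n\<^sup>2) (\<lambda>_. 0),
       lp_upper = vec (m * n\<^sup>2) (\<lambda>_. \<infinity>) \<rparr>"

definition prob_simplex :: "nat \<Rightarrow> real vec set" where
  "prob_simplex n = {v \<in> carrier_vec n. (\<forall>i<n. 0 \<le> v $ i) \<and> (\<Sum>i<n. v $ i) = 1}"

definition nonneg_mats :: "nat \<Rightarrow> real mat set" where
  "nonneg_mats n = {X \<in> carrier_mat n n. \<forall>i<n. \<forall>j<n. 0 \<le> X $$ (i, j)}"

lemma wf_fswbp_lp: "wf_linear_program (fswbp_lp m n u C)"
  by (simp add: wf_linear_program_def fswbp_lp_def fswbp_matrix_def fswbp_rhs_def
      block_matrix_def block_vector_def)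

end

theory Submission
  imports Defs
begin

text \<open>Every column belonging to \<open>X\<^sub>2\<close> has one nonzero entry in the block row of \<open>E\<close> and one in each
  of the two block rows of \<open>G\<close>, the latter two of equal sign, which no incidence matrix allows.
  Keeping only some of the rows turns the columns into edges of a graph on these rows. An edge
  joining the two \<open>G\<close> entries of a column of \<open>X\<^sub>2\<close> has equal signs, all other edges have
  opposite signs. For \<open>n \<ge> 3\<close> the rows can be chosen so that seven of these edges form a cycle
  with exactly one edge of equal signs; the corresponding minor is \<open>\<plusminus>2\<close>.\<close>

text \<open>\<open>pick\<close> enumerates a set increasingly. In a strictly sorted list exactly the
  first \<open>k\<close> entries lie below \<open>xs ! k\<close>, and counting smaller members
  determines the position of an element.\<close>

lemma pick_set_nth:
  assumes "sorted_wrt (<) xs" and "k < length xs"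
  shows "pick (set xs) k = xs ! k"
proof -
  have less_iff: "xs ! j < xs ! k \<longleftrightarrow> j < k" if "j < length xs" for j
    using assms that sorted_wrt_nth_less[OF assms(1)]
    by (metis linorder_neqE_nat order_less_asym order_less_irrefl)
  have inj: "inj_on ((!) xs) {..<k}"
    using assms by (intro inj_onI)
      (metis lessThan_iff linorder_neqE_nat order_less_irrefl order_less_trans sorted_wrt_nth_less)
  have "{a \<in> set xs. a < xs ! k} = (!) xs ` {..<k}"
  proof (intro equalityI subsetI)
    fix a
    assume "a \<in> {a \<in> set xs. a < xs ! k}"
    then show "a \<in> (!) xs ` {..<k}"
      using less_iff by (auto simp: in_set_conv_nth)
  next
    fix a
    assume "a \<in> (!) xs ` {..<k}"
    then obtain j where "a = xs ! j" "j < k"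
      by auto
    then show "a \<in> {a \<in> set xs. a < xs ! k}"
      using less_iff[of j] assms(2) by simp
  qed
  then have "card {a \<in> set xs. a < xs ! k} = k"
    using inj by (simp add: card_image)
  then show ?thesis
    using pick_card_in_set[of "xs ! k" "set xs"] assms(2) by simp
qed

lemma submatrix_set:
  assumes "sorted_wrt (<) rs" and "sorted_wrt (<) cs"
    and "set rs \<subseteq> {..<dim_row A}" and "set cs \<subseteq> {..<dim_col A}"
  shows "submatrix A (set rs) (set cs) =
    mat (length rs) (length cs) (\<lambda>(i, j). A $$ (rs ! i, cs ! j))"
proof -
  have "{i. i < dim_row A \<and> i \<in> set rs} = set rs" "{j. j < dim_col A \<and> j \<in> set cs} = set cs"
    using assms(3,4) by auto
  moreover have "card (set rs) = length rs" "card (set cs) = length cs"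
    using assms(1,2) by (simp_all add: strict_sorted_iff distinct_card)
  ultimately show ?thesis
    unfolding submatrix_def
    by (intro eq_matI) (simp_all add: pick_set_nth[OF assms(1)] pick_set_nth[OF assms(2)])
qed

text \<open>The conditional keeps the simplifier from expanding minors with coefficient zero.\<close>

lemma det_mat_of_rows_list_Cons:
  fixes r :: "'a :: comm_ring_1 list"
  assumes "length rs = n" and "\<forall>x \<in> set rs. length x = Suc n"
  shows "det (mat_of_rows_list (Suc n) (r # rs)) =
    (\<Sum>j<Suc n. if r ! j = 0 then 0 else (-1) ^ j * r ! j *
      det (mat_of_rows_list n (map (\<lambda>x. take j x @ drop (Suc j) x) rs)))"
proof -
  let ?A = "mat_of_rows_list (Suc n) (r # rs)"
  have "mat_delete ?A 0 j = mat_of_rows_list n (map (\<lambda>x. take j x @ drop (Suc j) x) rs)"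
    if "j < Suc n" for j
    using that assms
    by (intro eq_matI) (auto simp: mat_delete_def mat_of_rows_list_def nth_append min_def)
  moreover have "?A $$ (0, j) = r ! j" if "j < Suc n" for j
    using that by (simp add: mat_of_rows_list_def)
  moreover have "?A \<in> carrier_mat (Suc n) (Suc n)"
    using assms(1) by (simp add: mat_of_rows_list_def)
  ultimately show ?thesis
    by (subst laplace_expansion_row[of ?A "Suc n" 0])
      (auto simp: cofactor_def algebra_simps intro!: sum.cong)
qed

lemma det_mat_of_rows_list_Nil: "det (mat_of_rows_list 0 []) = 1"
  by (simp add: mat_of_rows_list_def det_def)

lemma block_index_less:
  fixes r i :: nat
  assumes "r < R" and "i < p"
  shows "r * p + i < R * p"
proof -
  have "r * p + i < Suc r * p"
    using assms(2) by simp
  also have "\<dots> \<le> R * p"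
    using assms(1) by (intro mult_le_mono1) simp
  finally show ?thesis .
qed

lemma dim_fswbp_matrix:
  "dim_row (fswbp_matrix m n) = (2 * m - 1) * n"
  "dim_col (fswbp_matrix m n) = m * n\<^sup>2"
  by (simp_all add: fswbp_matrix_def block_matrix_def)

text \<open>Blocks count from 0 here but from 1 in \<open>fswbp_block\<close>. After the shift both
  \<open>G\<close> entries of a column carry the sign \<open>(-1) ^ c\<close>, which depends on the
  block column alone; this is the source of the equal signs.\<close>

lemma fswbp_matrix_entry:
  assumes "r < 2 * m - 1" and "c < m" and "i < n" and "a < n" and "b < n"
  shows "fswbp_matrix m n $$ (r * n + i, c * n\<^sup>2 + (a * n + b)) =
    (if r < m then if c = r \<and> i = a then (-1) ^ (r + 1) else 0
     else if i \<noteq> b then 0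
     else if c = r - m then (-1) ^ c else if c = r - m + 1 then (-1) ^ c else 0)"
proof -
  have col: "a * n + b < n\<^sup>2"
    using block_index_less[OF assms(4,5)] by (simp add: power2_eq_square)
  have divmod: "(r * n + i) div n = r" "(r * n + i) mod n = i" "(a * n + b) div n = a"
    "(a * n + b) mod n = b" "(c * n\<^sup>2 + (a * n + b)) div n\<^sup>2 = c"
    "(c * n\<^sup>2 + (a * n + b)) mod n\<^sup>2 = a * n + b"
    using assms col by auto
  have E: "E_mat n $$ (p, a * n + b) = (if p = a then 1 else 0)" if "p < n" for p
    using assms that col by (simp add: E_mat_def kronecker_def ones_row_def divmod power2_eq_square)
  have G: "G_mat n $$ (p, a * n + b) = (if p = b then 1 else 0)" if "p < n" for p
    using assms that col by (simp add: G_mat_def kronecker_def ones_row_def divmod power2_eq_square)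
  have dims: "dim_row (E_mat n) = n" "dim_col (E_mat n) = n\<^sup>2"
    "dim_row (G_mat n) = n" "dim_col (G_mat n) = n\<^sup>2"
    by (simp_all add: E_mat_def G_mat_def kronecker_def ones_row_def power2_eq_square)
  have "fswbp_matrix m n $$ (r * n + i, c * n\<^sup>2 + (a * n + b)) =
      fswbp_block m n (r + 1) (c + 1) $$ (i, a * n + b)"
    using block_index_less[OF assms(1,3)] block_index_less[OF assms(2) col]
    by (simp only: fswbp_matrix_def block_matrix_def index_mat(1) prod.case divmod)
  also have "\<dots> = (if r < m then if c = r \<and> i = a then (-1) ^ (r + 1) else 0
     else if i \<noteq> b then 0
     else if c = r - m then (-1) ^ c else if c = r - m + 1 then (-1) ^ c else 0)"
  proof (cases "r < m")
    case True
    then show ?thesis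
      using assms(3) col by (simp add: fswbp_block_def E dims)
  next
    case False
    \<comment> \<open>Subtraction on \<open>nat\<close> truncates, so this needs
      \<open>m \<le> r\<close>.\<close>
    then have "r + 1 - m = r - m + 1"
      by simp
    then show ?thesis
      using False assms(3) col by (simp add: fswbp_block_def G dims)
  qed
  finally show ?thesis .
qed

lemma fswbp_matrix_not_incidence:
  assumes "m \<ge> 3" and "n \<ge> 1"
  shows "\<not> is_incidence_matrix (fswbp_matrix m n) G"
proof
  assume inc: "is_incidence_matrix (fswbp_matrix m n) G"
  \<comment> \<open>Column \<open>n\<^sup>2\<close> belongs to entry \<open>(0, 0)\<close> of the
    second matrix. Its two \<open>G\<close> entries are both \<open>-1\<close>, so two distinct rows
    would have to be the head of one arc.\<close>
  have "r * n = head G (n\<^sup>2)" if "r \<in> {m, m + 1}" for r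
  proof -
    have "fswbp_matrix m n $$ (r * n, n\<^sup>2) = -1"
      using fswbp_matrix_entry[of r m 1 0 n 0 0] that assms by auto
    moreover have "r * n < (2 * m - 1) * n" "n\<^sup>2 < m * n\<^sup>2"
      using that assms by auto
    ultimately show ?thesis
      using inc by (auto simp: is_incidence_matrix_def dim_fswbp_matrix split: if_splits)
  qed
  from this[of m] this[of "m + 1"] show False
    using assms by simp
qed

text \<open>The cycle visits the rows in the order 0, 3, 5, 2, 6, 1, 4, counted from 0. Column 4,
  joining rows 3 and 5, is the edge of equal signs.\<close>

definition unbalanced_cycle :: "real list list" where
  "unbalanced_cycle =
    [[-1, -1,  0,  0,  0,  0,  0],
     [ 0,  0,  1,  1,  0,  0,  0],
     [ 0,  0,  0,  0,  0, -1, -1],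
     [ 1,  0,  0,  0, -1,  0,  0],
     [ 0,  1, -1,  0,  0,  0,  0],
     [ 0,  0,  0,  0, -1,  1,  0],
     [ 0,  0,  0, -1,  0,  0,  1]]"

text \<open>Only the two perfect matchings between rows and columns contribute to the determinant.
  Their products multiply to \<open>(-1) ^ 6 = 1\<close>, hence agree, and they add up because a
  7-cycle is an even permutation.\<close>

lemma abs_det_unbalanced_cycle: "\<bar>det (mat_of_rows_list 7 unbalanced_cycle)\<bar> = 2"
  by (simp add: unbalanced_cycle_def eval_nat_numeral det_mat_of_rows_list_Cons
      det_mat_of_rows_list_Nil)

lemma fswbp_matrix_not_totally_unimodular:
  assumes "m \<ge> 3" and "n \<ge> 3"
  shows "\<not> totally_unimodular (fswbp_matrix m n)"
proof
  assume tu: "totally_unimodular (fswbp_matrix m n)"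
  \<comment> \<open>Rows are pairs (block row, index), columns are triples (block column, row and column of the
    entry of \<open>X\<close>), all counted from 0. The equal-sign edge of the cycle is column \<open>(1, 1, 0)\<close>,
    joining rows \<open>(m, 0)\<close> and \<open>(m + 1, 0)\<close>; the row \<open>(1, 1)\<close> of its \<open>E\<close> entry is left out.\<close>
  define rp :: "(nat \<times> nat) list" where "rp =
    [(0, 0), (1, 0), (2, 0), (m, 0), (m, 1), (m + 1, 0), (m + 1, 2)]"
  define cp :: "(nat \<times> nat \<times> nat) list" where "cp =
    [(0, 0, 0), (0, 0, 1), (1, 0, 1), (1, 0, 2), (1, 1, 0), (2, 0, 0), (2, 0, 2)]"
  define rs where "rs = map (\<lambda>(r, i). r * n + i) rp"
  define cs where "cs = map (\<lambda>(c, a, b). c * n\<^sup>2 + (a * n + b)) cp"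
  define e :: "nat \<times> nat \<Rightarrow> nat \<times> nat \<times> nat \<Rightarrow> real" where "e = (\<lambda>(r, p) (c, a, b).
    if r < m then if c = r \<and> p = a then (-1) ^ (r + 1) else 0
    else if p \<noteq> b then 0
    else if c = r - m then (-1) ^ c else if c = r - m + 1 then (-1) ^ c else 0)"
  have len_rs: "length rs = 7"
    by (simp add: rs_def rp_def)
  have len_cs: "length cs = 7"
    by (simp add: cs_def cp_def)
  \<comment> \<open>These two bounds let linear arithmetic treat \<open>n\<^sup>2\<close> and
    \<open>m * n\<close> as atoms when ordering the chosen rows and columns.\<close>
  have n2: "n * 3 \<le> n\<^sup>2"
    using assms(2) by (simp add: power2_eq_square)
  have mn: "3 * n \<le> m * n"
    using assms(1) by simp
  have sorted_rs: "sorted_wrt (<) rs"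
    by (simp add: rs_def rp_def) (use assms mn in linarith)
  have sorted_cs: "sorted_wrt (<) cs"
    by (simp add: cs_def cp_def) (use assms n2 in linarith)
  have rp_bound: "\<forall>(r, i) \<in> set rp. r < 2 * m - 1 \<and> i < n"
    by (simp add: rp_def) (use assms in linarith)
  have cp_bound: "\<forall>(c, a, b) \<in> set cp. c < m \<and> a < n \<and> b < n"
    using assms by (simp add: cp_def)
  have rs_bound: "set rs \<subseteq> {..<(2 * m - 1) * n}"
    using rp_bound by (auto simp: rs_def intro: block_index_less)
  have "c * n\<^sup>2 + (a * n + b) < m * n\<^sup>2" if "c < m" "a < n" "b < n" for c a b
    using that block_index_less[of a n b n]
    by (intro block_index_less) (simp_all add: power2_eq_square)
  then have cs_bound: "set cs \<subseteq> {..<m * n\<^sup>2}"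
    using cp_bound by (auto simp: cs_def)
  have sub: "submatrix (fswbp_matrix m n) (set rs) (set cs) =
      mat 7 7 (\<lambda>(i, j). fswbp_matrix m n $$ (rs ! i, cs ! j))"
    using submatrix_set[OF sorted_rs sorted_cs, of "fswbp_matrix m n"] rs_bound cs_bound
    by (simp add: dim_fswbp_matrix len_rs len_cs)
  have entry: "fswbp_matrix m n $$ (rs ! i, cs ! j) = unbalanced_cycle ! i ! j" if "i < 7" "j < 7" for i j
  proof -
    obtain r p where ri: "rp ! i = (r, p)" by (cases "rp ! i")
    obtain c a b where cj: "cp ! j = (c, a, b)" by (cases "cp ! j")
    have i: "i < length rp"
      using that(1) by (simp add: rp_def)
    have j: "j < length cp"
      using that(2) by (simp add: cp_def)
    have "r < 2 * m - 1 \<and> p < n"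
      using bspec[OF rp_bound nth_mem[OF i]] by (simp add: ri)
    moreover have "c < m \<and> a < n \<and> b < n"
      using bspec[OF cp_bound nth_mem[OF j]] by (simp add: cj)
    ultimately have "fswbp_matrix m n $$ (r * n + p, c * n\<^sup>2 + (a * n + b)) = e (r, p) (c, a, b)"
      using fswbp_matrix_entry[of r m c p n a b] by (simp add: e_def)
    moreover have "rs ! i = r * n + p"
      using i ri by (simp add: rs_def)
    moreover have "cs ! j = c * n\<^sup>2 + (a * n + b)"
      using j cj by (simp add: cs_def)
    ultimately have "fswbp_matrix m n $$ (rs ! i, cs ! j) = e (r, p) (c, a, b)"
      by simp
    also have "\<dots> = map (\<lambda>x. map (e x) cp) rp ! i ! j"
      using i j ri cj by simp
    \<comment> \<open>The function \<open>e\<close> does not mention \<open>n\<close>, and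
      \<open>m \<ge> 3\<close> decides every comparison with the symbolic \<open>m\<close>, so the
      whole table evaluates by simplification.\<close>
    also have "map (\<lambda>x. map (e x) cp) rp = unbalanced_cycle"
      using assms(1) by (simp add: e_def rp_def cp_def unbalanced_cycle_def)
    finally show ?thesis .
  qed
  have "length unbalanced_cycle = 7"
    by (simp add: unbalanced_cycle_def)
  then have "submatrix (fswbp_matrix m n) (set rs) (set cs) = mat_of_rows_list 7 unbalanced_cycle"
    unfolding sub mat_of_rows_list_def by (intro cong_mat) (simp_all add: entry)
  then have "det (submatrix (fswbp_matrix m n) (set rs) (set cs)) \<notin> {-1, 0, 1}"
    using abs_det_unbalanced_cycle by auto
  moreover have "card (set rs) = card (set cs)"
    using sorted_rs sorted_cs by (simp add: strict_sorted_iff distinct_card len_rs len_cs)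
  ultimately show False
    using tu rs_bound cs_bound unfolding totally_unimodular_def dim_fswbp_matrix by blast
qed

theorem theorem3p8:
  fixes m n :: nat
    and u :: "nat \<Rightarrow> real vec"
    and C :: "nat \<Rightarrow> real mat"
  assumes "m \<ge> 3" and "n \<ge> 3"
    and "\<And>k. k \<in> {1..m} \<Longrightarrow> u k \<in> prob_simplex n"
    and "\<And>k. k \<in> {1..m} \<Longrightarrow> C k \<in> nonneg_mats n"
  shows "\<not> min_cost_flow_problem (fswbp_lp m n u C) \<and>
         \<not> totally_unimodular (fswbp_matrix m n)"
  using assms fswbp_matrix_not_incidence[of m n] fswbp_matrix_not_totally_unimodular[of m n]
  by (auto simp: min_cost_flow_problem_def fswbp_lp_def)

end
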